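(* Let $\mathfrak{G}$ be a permutation group acting transitively on a finite set $V$. For distinct $v',v''\in V$ let $\mathcal{B}(v',v'')$ be the bipartite graph whose vertex set is the disjoint union of the set of orbits of the stabilizer $\mathfrak{G}_{v'}$ on $V$ and the set of orbits of $\mathfrak{G}_{v''}$ on $V$, where an orbit $O'$ of $\mathfrak{G}_{v'}$ is adjacent to an orbit $O''$ of $\mathfrak{G}_{v''}$ iff $O'\cap O''\neq\emptyset$. Then $\mathfrak{G}$ is primitive if and only if one of the following occurs: (i) $\mathcal{B}(v',v'')$ is connected for all distinct $v',v''\in V$; (ii) for all distinct $v',v''\in V$, $\mathcal{B}(v',v'')$ is a perfect matching consisting of $|V|$ edges, and $|V|$ is a prime number; moreover, in case (ii) $\mathfrak{G}$ is a cyclic group of prime order.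
   Context: $\mathfrak{G}_v=\{\sigma\in\mathfrak{G}:\sigma v=v\}$. A block is a nonempty subset $B$ of an orbit with $\sigma B=B$ or $\sigma B\cap B=\emptyset$ for every $\sigma\in\mathfrak{G}$. A transitive $\mathfrak{G}$ is primitive if its only blocks are the singletons and $V$ itself. *)

theory Defs
  imports
    "HOL-Algebra.Group_Action"
    "HOL-Algebra.Elementary_Groups"
    "HOL-Computational_Algebra.Primes"
    "Graph_Theory.Graph_Theory"
begin

text \<open>
  A permutation group on \<open>V\<close> is given by the set \<open>S\<close> of its elements, a subgroup of the symmetric
  group \<open>BijGroup V\<close>. Elements of \<open>BijGroup V\<close> are bijections of \<open>V\<close> that take the value
  \<open>undefined\<close> outside \<open>V\<close>. The natural action on \<open>V\<close> is \<open>id\<close>, so the library notions of orbit,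
  stabilizer and transitive action apply with \<open>\<phi> = id\<close>.
\<close>

abbreviation perm_group :: "'a set \<Rightarrow> ('a \<Rightarrow> 'a) set \<Rightarrow> ('a \<Rightarrow> 'a) monoid" where
  "perm_group V S \<equiv> BijGroup V\<lparr>carrier := S\<rparr>"

definition block :: "'a set \<Rightarrow> ('a \<Rightarrow> 'a) set \<Rightarrow> 'a set \<Rightarrow> bool" where
  "block V S B \<longleftrightarrow>
     B \<noteq> {} \<and> (\<exists>Q \<in> orbits (perm_group V S) V id. B \<subseteq> Q) \<and>
     (\<forall>\<sigma> \<in> S. \<sigma> ` B = B \<or> \<sigma> ` B \<inter> B = {})"

definition primitive_group :: "'a set \<Rightarrow> ('a \<Rightarrow> 'a) set \<Rightarrow> bool" where
  "primitive_group V S \<longleftrightarrow>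
     transitive_action (perm_group V S) V id \<and>
     (\<forall>B. block V S B \<longrightarrow> is_singleton B \<or> B = V)"

definition stab_orbits :: "'a set \<Rightarrow> ('a \<Rightarrow> 'a) set \<Rightarrow> 'a \<Rightarrow> 'a set set" where
  "stab_orbits V S v = orbits (perm_group V (stabilizer (perm_group V S) id v)) V id"

text \<open>
  As usual in \<open>Graph_Theory\<close>, an undirected graph is a symmetric digraph: the undirected edge
  between \<open>Inl Q1\<close> and \<open>Inr Q2\<close> is represented by both of its orientations.
\<close>

definition orbit_graph ::
    "'a set \<Rightarrow> ('a \<Rightarrow> 'a) set \<Rightarrow> 'a \<Rightarrow> 'a \<Rightarrow> ('a set + 'a set) pair_pre_digraph" where
  "orbit_graph V S v1 v2 =
     \<lparr>pverts = stab_orbits V S v1 <+> stab_orbits V S v2,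
      parcs = (\<Union>Q1 \<in> stab_orbits V S v1. \<Union>Q2 \<in> {Q \<in> stab_orbits V S v2. Q1 \<inter> Q \<noteq> {}}.
                 {(Inl Q1, Inr Q2), (Inr Q2, Inl Q1)})\<rparr>"

text \<open>
  The two orientations of an undirected edge yield the same element of \<open>undirected_edges\<close>.
\<close>

definition undirected_edges :: "('v, 'e) pre_digraph \<Rightarrow> 'v set set" where
  "undirected_edges H = {{u, w} | u w. (u, w) \<in> arcs_ends H}"

definition perfect_matching_graph :: "('v, 'e) pre_digraph \<Rightarrow> bool" where
  "perfect_matching_graph H \<longleftrightarrow> (\<forall>u \<in> verts H. \<exists>!e. e \<in> undirected_edges H \<and> u \<in> e)"

end

theory Submission
  imports Defs "HOL-Algebra.Sylow"
begin

text \<open>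
  A block through two distinct points \<open>v1\<close>, \<open>v2\<close> is invariant under both stabilizers, so it separates
  the orbit graph; hence connectedness of all orbit graphs forces primitivity, and so does a prime
  degree, because the size of a block divides \<open>card V\<close>. Conversely, an orbit of a subgroup that
  contains a point stabilizer is a block. Applied to the subgroup generated by the stabilizers of
  \<open>v1\<close> and \<open>v2\<close>, this shows for primitive groups that either this subgroup is transitive, and the
  orbit graph is connected, or the two stabilizers coincide. In the latter case all stabilizers
  coincide, since having the same stabilizer defines a block, so the action is regular; a subgroup
  of prime order, which exists by Cauchy's theorem, then has to be transitive.
\<close>

lemma (in group) prime_order_imp_cyclic:
  assumes "Factorial_Ring.prime (Coset.order G)"
  shows "cyclic_group G"
proof -
  have fin: "finite (carrier G)"
    using prime_gt_0_nat[OF assms] by (simp add: order_gt_0_iff_finite)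
  have "carrier G \<noteq> {\<one>}"
    using assms by (auto simp: Coset.order_def)
  then obtain g where g: "g \<in> carrier G" "g \<noteq> \<one>"
    by blast
  let ?H = "generate G {g}"
  have H: "subgroup ?H G"
    using g by (intro generate_is_subgroup) auto
  then have sub: "?H \<subseteq> carrier G"
    by (rule subgroup.subset)
  have "card ?H dvd Coset.order G"
    using lagrange[OF H] by (metis dvd_triv_right)
  moreover have "card {\<one>, g} \<le> card ?H"
    using fin sub by (intro card_mono) (auto intro: generate.one generate.incl finite_subset)
  then have "card ?H \<noteq> 1"
    using g by simp
  ultimately have "card ?H = Coset.order G"
    using prime_nat_iff[THEN iffD1, OF assms] by blast
  then have "?H = carrier G"
    using fin sub by (simp add: Coset.order_def card_subset_eq)
  then show ?thesis
    unfolding cyclic_group_def subgroup_generated_def using g by (intro bexI[of _ g]) auto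
qed

context group_action
begin

lemma image_mult:
  assumes "g \<in> carrier G" "h \<in> carrier G" "B \<subseteq> E"
  shows "\<phi> (g \<otimes> h) ` B = \<phi> g ` \<phi> h ` B"
  using assms composition_rule by (force simp: image_image intro!: image_cong)

lemma action_inv_eq_iff:
  assumes "g \<in> carrier G" "x \<in> E" "y \<in> E"
  shows "\<phi> (inv g) y = x \<longleftrightarrow> y = \<phi> g x"
proof
  interpret group G
    using group_hom group_hom.axioms(1) by auto
  show "y = \<phi> g x" if "\<phi> (inv g) y = x"
    using orbit_sym_aux[OF inv_closed[OF assms(1)] assms(3) that] assms(1) by simp
  show "\<phi> (inv g) y = x" if "y = \<phi> g x"
    using assms(1,2) that[symmetric] by (rule orbit_sym_aux)
qed

lemma orbit_cong:
  assumes x: "x \<in> E" and y: "y \<in> Group_Action.orbit G \<phi> x"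
  shows "Group_Action.orbit G \<phi> y = Group_Action.orbit G \<phi> x"
proof -
  have sub: "Group_Action.orbit G \<phi> z \<subseteq> E" if "z \<in> E" for z
    using element_image[OF _ that refl] by (auto simp: Group_Action.orbit_def)
  have yE: "y \<in> E"
    using sub[OF x] y by blast
  show ?thesis
  proof
    show "Group_Action.orbit G \<phi> y \<subseteq> Group_Action.orbit G \<phi> x"
      using orbit_trans[OF x yE _ y] sub[OF yE] by blast
    show "Group_Action.orbit G \<phi> x \<subseteq> Group_Action.orbit G \<phi> y"
      using orbit_trans[OF yE x _ orbit_sym[OF x yE y]] sub[OF x] by blast
  qed
qed

lemma stabilizer_translate_cong:
  assumes "x \<in> E" "y \<in> E" and g: "g \<in> carrier G"
    and eq: "stabilizer G \<phi> x = stabilizer G \<phi> y"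
  shows "stabilizer G \<phi> (\<phi> g x) = stabilizer G \<phi> (\<phi> g y)"
proof -
  interpret group G
    using group_hom group_hom.axioms(1) by auto
  have conj: "h \<in> stabilizer G \<phi> (\<phi> g z) \<longleftrightarrow> inv g \<otimes> (h \<otimes> g) \<in> stabilizer G \<phi> z"
    if z: "z \<in> E" and h: "h \<in> carrier G" for h z
  proof -
    have gz: "\<phi> g z \<in> E"
      by (rule element_image[OF g z refl])
    have "\<phi> (inv g \<otimes> (h \<otimes> g)) z = \<phi> (inv g) (\<phi> h (\<phi> g z))"
      using g h z by (simp add: composition_rule)
    then show ?thesis
      using action_inv_eq_iff[OF g z element_image[OF h gz refl]] g h
      by (simp add: stabilizer_def)
  qed
  show ?thesis
    using conj[OF assms(1)] conj[OF assms(2)] stabilizer_subset unfolding eq by blast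
qed

lemma translate_eq_or_disjoint:
  assumes H: "subgroup H G" and x: "x \<in> E" and stab: "stabilizer G \<phi> x \<subseteq> H" and g: "g \<in> carrier G"
  defines "B \<equiv> Group_Action.orbit (G\<lparr>carrier := H\<rparr>) \<phi> x"
  shows "\<phi> g ` B = B \<or> \<phi> g ` B \<inter> B = {}"
proof (cases "\<phi> g ` B \<inter> B = {}")
  case False
  interpret group G
    using group_hom group_hom.axioms(1) by auto
  interpret H: subgroup H G
    by (rule H)
  from False obtain h k where hk: "h \<in> H" "k \<in> H" "\<phi> g (\<phi> h x) = \<phi> k x"
    by (auto simp: B_def Group_Action.orbit_def)
  have "inv k \<otimes> (g \<otimes> h) \<in> stabilizer G \<phi> x"
    using hk g x element_image[OF _ x refl] action_inv_eq_iff[of k x "\<phi> k x"] H.mem_carrier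
    by (auto simp: stabilizer_def composition_rule)
  then have "k \<otimes> (inv k \<otimes> (g \<otimes> h)) \<otimes> inv h \<in> H"
    using stab hk by blast
  moreover have "k \<otimes> (inv k \<otimes> (g \<otimes> h)) = g \<otimes> h"
    using hk g by (simp add: m_assoc[symmetric])
  moreover have "g \<otimes> h \<otimes> inv h = g"
    using hk g by (simp add: m_assoc)
  ultimately have gH: "g \<in> H"
    by simp
  have sub: "\<phi> f ` B \<subseteq> B" if "f \<in> H" for f
  proof -
    have "\<phi> f (\<phi> h x) = \<phi> (f \<otimes> h) x" if "h \<in> H" for h
      using that \<open>f \<in> H\<close> x by (simp add: composition_rule)
    with that show ?thesis
      by (force simp: B_def Group_Action.orbit_def)
  qed
  have B: "B \<subseteq> E"
    using element_image[OF _ x refl] by (auto simp: B_def Group_Action.orbit_def)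
  have "B \<subseteq> \<phi> g ` B"
  proof
    fix y assume y: "y \<in> B"
    then have inv_y: "\<phi> (inv g) y \<in> B"
      using sub[of "inv g"] gH by blast
    have "y = \<phi> g (\<phi> (inv g) y)"
      using action_inv_eq_iff[OF g subsetD[OF B inv_y] subsetD[OF B y]] by simp
    then show "y \<in> \<phi> g ` B"
      using inv_y by (rule image_eqI)
  qed
  with sub[OF gH] show ?thesis
    by blast
qed simp

end

lemma (in transitive_action) card_dvd_if_translates_eq_or_disjoint:
  assumes fin: "finite E" and B: "B \<subseteq> E" "B \<noteq> {}"
    and blk: "\<And>g. g \<in> carrier G \<Longrightarrow> \<phi> g ` B = B \<or> \<phi> g ` B \<inter> B = {}"
  shows "card B dvd card E"
proof -
  interpret group G
    using group_hom group_hom.axioms(1) by auto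
  define C where "C = (\<lambda>g. \<phi> g ` B) ` carrier G"
  have "\<Union>C \<subseteq> E"
    using B element_image by (auto simp: C_def)
  moreover have "E \<subseteq> \<Union>C"
    using B unique_orbit by (fastforce simp: C_def)
  ultimately have UC: "\<Union>C = E"
    by blast
  have "card B * card C = card (\<Union>C)"
  proof (rule card_partition)
    show "finite C" "finite (\<Union>C)"
      using UC fin finite_UnionD by auto
    show "card c = card B" if "c \<in> C" for c
      using that B inj_prop by (auto simp: C_def intro!: card_image intro: inj_on_subset)
    show "c1 \<inter> c2 = {}" if "c1 \<in> C" "c2 \<in> C" "c1 \<noteq> c2" for c1 c2
    proof (rule ccontr)
      assume "c1 \<inter> c2 \<noteq> {}"
      obtain g h where gh: "g \<in> carrier G" "h \<in> carrier G" "c1 = \<phi> g ` B" "c2 = \<phi> h ` B"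
        using \<open>c1 \<in> C\<close> \<open>c2 \<in> C\<close> unfolding C_def by blast
      with \<open>c1 \<inter> c2 \<noteq> {}\<close> obtain b b' where b: "b \<in> B" "b' \<in> B" "\<phi> g b = \<phi> h b'"
        by blast
      have E: "b \<in> E" "b' \<in> E" "\<phi> g b \<in> E"
        using b(1,2) B element_image[OF gh(1) _ refl, of b] by auto
      have "\<phi> (inv h \<otimes> g) b = \<phi> (inv h) (\<phi> g b)"
        using gh E by (intro composition_rule) auto
      also have "\<dots> = b'"
        using action_inv_eq_iff[OF gh(2) E(2,3)] b(3) by simp
      finally have "b' \<in> \<phi> (inv h \<otimes> g) ` B"
        using b(1) by blast
      then have "\<phi> (inv h \<otimes> g) ` B = B"
        using blk[of "inv h \<otimes> g"] gh b(2) by auto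
      then have "\<phi> (h \<otimes> (inv h \<otimes> g)) ` B = \<phi> h ` B"
        using gh B by (subst image_mult) auto
      then have "c1 = c2"
        using gh by (simp add: m_assoc[symmetric])
      with that show False
        by simp
    qed
  qed
  then show ?thesis
    by (metis UC dvd_triv_left)
qed

lemma mk_symmetric_orbit_graph: "mk_symmetric (with_proj (orbit_graph V S v1 v2)) = orbit_graph V S v1 v2"
  by (auto simp: mk_symmetric_def orbit_graph_def)

lemma connected_orbit_graph_iff:
  "Digraph_Component.connected (orbit_graph V S v1 v2) \<longleftrightarrow>
    pverts (orbit_graph V S v1 v2) \<noteq> {} \<and>
    (\<forall>u \<in> pverts (orbit_graph V S v1 v2). \<forall>w \<in> pverts (orbit_graph V S v1 v2).
      (u, w) \<in> (parcs (orbit_graph V S v1 v2))\<^sup>*)"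
proof -
  interpret wf_digraph "with_proj (orbit_graph V S v1 v2)"
    by standard (auto simp: orbit_graph_def)
  show ?thesis
    using reachable_conv'
    by (auto simp: Digraph_Component.connected_def mk_symmetric_orbit_graph strongly_connected_def)
qed

lemma undirected_edges_orbit_graph:
  "undirected_edges (orbit_graph V S v1 v2) =
    {{Inl Q1, Inr Q2} | Q1 Q2. Q1 \<in> stab_orbits V S v1 \<and> Q2 \<in> stab_orbits V S v2 \<and> Q1 \<inter> Q2 \<noteq> {}}"
  (is "_ = ?R")
proof
  show "undirected_edges (orbit_graph V S v1 v2) \<subseteq> ?R"
    by (auto simp: undirected_edges_def orbit_graph_def)
  show "?R \<subseteq> undirected_edges (orbit_graph V S v1 v2)"
    by (fastforce simp: undirected_edges_def orbit_graph_def)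
qed

locale transitive_perm_group =
  fixes V :: "'a set" and S :: "('a \<Rightarrow> 'a) set"
  assumes finite_V: "finite V"
    and subgroup_S: "subgroup S (BijGroup V)"
    and transitive: "transitive_action (perm_group V S) V id"
begin

sublocale transitive_action "perm_group V S" V id
  by (rule transitive)

sublocale group "perm_group V S"
  using group_hom group_hom.axioms(1) by auto

abbreviation "stab \<equiv> stabilizer (perm_group V S) id"

abbreviation "stab_orbit v x \<equiv> Group_Action.orbit (perm_group V (stab v)) id x"

lemma stab_action: "v \<in> V \<Longrightarrow> group_action (perm_group V (stab v)) V id"
  using induced_action[OF stabilizer_subgroup] by simp

lemma stab_orbits_eq: "stab_orbits V S v = stab_orbit v ` V"
  by (auto simp: stab_orbits_def orbits_def)

lemma finite_S: "finite S"
proof (rule finite_subset)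
  show "S \<subseteq> (\<Pi>\<^sub>E x\<in>V. V)"
    using subgroup.subset[OF subgroup_S] by (auto simp: BijGroup_def Bij_def bij_betw_def PiE_def)
  show "finite (\<Pi>\<^sub>E x\<in>V. V)"
    using finite_V by (intro finite_PiE) auto
qed

lemma orbit_eq:
  assumes "x \<in> V"
  shows "Group_Action.orbit (perm_group V S) id x = V"
proof
  show "Group_Action.orbit (perm_group V S) id x \<subseteq> V"
    using element_image[OF _ assms refl] by (auto simp: Group_Action.orbit_def)
  show "V \<subseteq> Group_Action.orbit (perm_group V S) id x"
    using unique_orbit[OF assms] by (fastforce simp: Group_Action.orbit_def)
qed

lemma block_iff:
  "block V S B \<longleftrightarrow> B \<noteq> {} \<and> B \<subseteq> V \<and> (\<forall>\<sigma> \<in> S. \<sigma> ` B = B \<or> \<sigma> ` B \<inter> B = {})"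
proof -
  have "orbits (perm_group V S) V id = (\<lambda>_. V) ` V"
    unfolding orbits_def using orbit_eq by blast
  then show ?thesis
    unfolding block_def by blast
qed

lemma primitive_orbit_subgroup:
  assumes "primitive_group V S" "subgroup H (perm_group V S)" "x \<in> V" "stab x \<subseteq> H"
  shows "Group_Action.orbit (perm_group V H) id x = {x} \<or> Group_Action.orbit (perm_group V H) id x = V"
proof -
  interpret H: group_action "perm_group V H" V id
    using induced_action[OF assms(2)] by simp
  have x: "x \<in> Group_Action.orbit (perm_group V H) id x"
    using assms(3) by (rule H.orbit_refl)
  have "Group_Action.orbit (perm_group V H) id x \<subseteq> V"
    using H.element_image[OF _ assms(3) refl] by (auto simp: Group_Action.orbit_def)
  moreover have "\<sigma> ` Group_Action.orbit (perm_group V H) id x = Group_Action.orbit (perm_group V H) id x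
      \<or> \<sigma> ` Group_Action.orbit (perm_group V H) id x \<inter> Group_Action.orbit (perm_group V H) id x = {}" if "\<sigma> \<in> S" for \<sigma>
    using translate_eq_or_disjoint[OF assms(2-4), of \<sigma>] that by simp
  ultimately have "block V S (Group_Action.orbit (perm_group V H) id x)"
    unfolding block_iff using x by blast
  then have "is_singleton (Group_Action.orbit (perm_group V H) id x) \<or>
      Group_Action.orbit (perm_group V H) id x = V"
    using assms(1) unfolding primitive_group_def by blast
  with x show ?thesis
    by (elim disjE is_singletonE) simp_all
qed

lemma connected_if_generate_transitive:
  assumes v: "v1 \<in> V" "v2 \<in> V" and x: "x \<in> V"
    and trans: "Group_Action.orbit (perm_group V (generate (perm_group V S) (stab v1 \<union> stab v2))) id x = V"
  shows "Digraph_Component.connected (orbit_graph V S v1 v2)"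
proof -
  let ?A = "parcs (orbit_graph V S v1 v2)"
  let ?l = "\<lambda>x. Inl (stab_orbit v1 x) :: 'a set + 'a set" and ?r = "\<lambda>x. Inr (stab_orbit v2 x) :: 'a set + 'a set"
  interpret A1: group_action "perm_group V (stab v1)" V id
    using v by (intro stab_action)
  interpret A2: group_action "perm_group V (stab v2)" V id
    using v by (intro stab_action)
  have lr: "(?l y, ?r y) \<in> ?A" "(?r y, ?l y) \<in> ?A" if "y \<in> V" for y
    using that A1.orbit_refl[OF that] A2.orbit_refl[OF that]
    by (auto simp: orbit_graph_def stab_orbits_eq)
  have step: "(?l y, ?l z) \<in> ?A\<^sup>*" if "y \<in> V" "z \<in> V" "z \<in> stab_orbit v1 y \<or> z \<in> stab_orbit v2 y" for y z
    using that(3)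
  proof
    assume "z \<in> stab_orbit v1 y"
    then have "stab_orbit v1 y = stab_orbit v1 z"
      using A1.orbit_cong[OF that(1)] by simp
    then show ?thesis
      by simp
  next
    assume "z \<in> stab_orbit v2 y"
    then have "stab_orbit v2 y = stab_orbit v2 z"
      using A2.orbit_cong[OF that(1)] by simp
    then show ?thesis
      using lr(1)[OF that(1)] lr(2)[OF that(2)]
      by (simp add: rtrancl.rtrancl_into_rtrancl[OF r_into_rtrancl])
  qed
  have stab_step: "\<forall>y \<in> V. \<sigma> y \<in> V \<and> (?l y, ?l (\<sigma> y)) \<in> ?A\<^sup>*" if "\<sigma> \<in> stab v1 \<union> stab v2" for \<sigma>
  proof
    fix y assume "y \<in> V"
    moreover have "\<sigma> \<in> S"
      using that stabilizer_subset by auto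
    ultimately have "\<sigma> y \<in> V"
      using element_image by auto
    with \<open>y \<in> V\<close> show "\<sigma> y \<in> V \<and> (?l y, ?l (\<sigma> y)) \<in> ?A\<^sup>*"
      using that step[of y "\<sigma> y"] by (force simp: Group_Action.orbit_def)
  qed
  have gen: "\<forall>y \<in> V. \<sigma> y \<in> V \<and> (?l y, ?l (\<sigma> y)) \<in> ?A\<^sup>*"
    if "\<sigma> \<in> generate (perm_group V S) (stab v1 \<union> stab v2)" for \<sigma>
    using that
  proof induction
    case one
    show ?case
      by (simp add: BijGroup_def)
  next
    case (incl h)
    then show ?case
      by (rule stab_step)
  next
    case (inv h)
    then have "inv\<^bsub>perm_group V S\<^esub> h \<in> stab v1 \<union> stab v2"
      using v stabilizer_m_inv_closed by blast
    then show ?case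
      by (rule stab_step)
  next
    case (eng g h)
    then have "g \<in> S" "h \<in> S"
      using generate_in_carrier[of "stab v1 \<union> stab v2"] stabilizer_subset by auto
    then have comp: "(g \<otimes>\<^bsub>perm_group V S\<^esub> h) y = g (h y)" if "y \<in> V" for y
      using composition_rule[of y g h] that by simp
    show ?case
    proof
      fix y assume y: "y \<in> V"
      then show "(g \<otimes>\<^bsub>perm_group V S\<^esub> h) y \<in> V \<and> (?l y, ?l ((g \<otimes>\<^bsub>perm_group V S\<^esub> h) y)) \<in> ?A\<^sup>*"
        unfolding comp[OF y] using eng.IH by (blast intro: rtrancl_trans)
    qed
  qed
  have l: "(?l x, ?l y) \<in> ?A\<^sup>*" if "y \<in> V" for y
  proof -
    from that trans obtain \<sigma> where "\<sigma> \<in> generate (perm_group V S) (stab v1 \<union> stab v2)" "y = \<sigma> x"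
      unfolding Group_Action.orbit_def by auto
    with gen x show ?thesis
      by blast
  qed
  have "sym ?A"
    by (auto simp: orbit_graph_def sym_def)
  then have sym: "sym (?A\<^sup>*)"
    by (rule sym_rtrancl)
  have reach: "(?l x, u) \<in> ?A\<^sup>*" if "u \<in> pverts (orbit_graph V S v1 v2)" for u
  proof -
    from that obtain y where y: "y \<in> V" and u: "u = ?l y \<or> u = ?r y"
      by (auto simp: orbit_graph_def stab_orbits_eq)
    from u show ?thesis
    proof
      show ?thesis if "u = ?l y"
        unfolding that by (rule l[OF y])
      show ?thesis if "u = ?r y"
        unfolding that by (rule rtrancl.rtrancl_into_rtrancl[OF l[OF y] lr(1)[OF y]])
    qed
  qed
  moreover have "?l x \<in> pverts (orbit_graph V S v1 v2)"
    using x by (auto simp: orbit_graph_def stab_orbits_eq)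
  moreover have "(u, w) \<in> ?A\<^sup>*"
    if "u \<in> pverts (orbit_graph V S v1 v2)" "w \<in> pverts (orbit_graph V S v1 v2)" for u w
    using symD[OF sym reach[OF that(1)]] reach[OF that(2)] by (rule rtrancl_trans)
  ultimately show ?thesis
    unfolding connected_orbit_graph_iff by blast
qed

lemma block_not_connected:
  assumes blk: "block V S B" and v: "v1 \<in> B" "v2 \<in> B" and x: "x \<in> V" "x \<notin> B"
  shows "\<not> Digraph_Component.connected (orbit_graph V S v1 v2)"
proof
  assume conn: "Digraph_Component.connected (orbit_graph V S v1 v2)"
  have B: "B \<subseteq> V"
    using blk by (simp add: block_iff)
  have inv: "\<sigma> ` B = B" if "\<sigma> \<in> stab v1 \<or> \<sigma> \<in> stab v2" for \<sigma>
    using blk that v by (fastforce simp: block_iff stabilizer_def)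
  have sep: "Q \<subseteq> B \<or> Q \<inter> B = {}" if "Q \<in> stab_orbits V S w" "w = v1 \<or> w = v2" for Q w
  proof -
    have w: "w \<in> V"
      using that v B by auto
    interpret A: group_action "perm_group V (stab w)" V id
      using w by (rule stab_action)
    have sub: "stab_orbit w y \<subseteq> B" if "y \<in> B" for y
      using that inv \<open>w = v1 \<or> w = v2\<close> by (auto simp: Group_Action.orbit_def)
    show ?thesis
    proof (cases "Q \<inter> B = {}")
      case False
      then obtain y where "y \<in> Q" "y \<in> B"
        by blast
      then have "Q = stab_orbit w y"
        using that(1) A.orbit_cong by (auto simp: stab_orbits_eq)
      with sub \<open>y \<in> B\<close> show ?thesis
        by blast
    qed simp
  qed
  interpret A1: group_action "perm_group V (stab v1)" V id
    using v B by (intro stab_action) auto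
  define P where "P = {u :: 'a set + 'a set. case u of Inl Q \<Rightarrow> Q \<subseteq> B | Inr Q \<Rightarrow> Q \<subseteq> B}"
  have step: "w \<in> P" if "(u, w) \<in> parcs (orbit_graph V S v1 v2)" "u \<in> P" for u w
    using that sep by (fastforce simp: orbit_graph_def P_def)
  have closed: "w \<in> P" if "(u, w) \<in> (parcs (orbit_graph V S v1 v2))\<^sup>*" "u \<in> P" for u w
    using that by (induction rule: rtrancl_induct) (auto intro: step)
  have "v1 \<in> V"
    using v B by auto
  then have "(Inl (stab_orbit v1 v1), Inl (stab_orbit v1 x)) \<in> (parcs (orbit_graph V S v1 v2))\<^sup>*"
    using conn x unfolding connected_orbit_graph_iff
    by (auto simp: orbit_graph_def stab_orbits_eq)
  moreover have "Inl (stab_orbit v1 v1) \<in> P"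
    using v by (auto simp: P_def Group_Action.orbit_def stabilizer_def)
  ultimately have "stab_orbit v1 x \<subseteq> B"
    using closed by (fastforce simp: P_def)
  then show False
    using A1.orbit_refl x by blast
qed

lemma primitive_if_connected:
  assumes "\<And>v1 v2. v1 \<in> V \<Longrightarrow> v2 \<in> V \<Longrightarrow> v1 \<noteq> v2 \<Longrightarrow> Digraph_Component.connected (orbit_graph V S v1 v2)"
  shows "primitive_group V S"
  unfolding primitive_group_def
proof (intro conjI allI impI transitive)
  fix B assume blk: "block V S B"
  then have B: "B \<noteq> {}" "B \<subseteq> V"
    by (auto simp: block_iff)
  show "is_singleton B \<or> B = V"
  proof (rule disjCI)
    assume "B \<noteq> V"
    then obtain x where "x \<in> V" "x \<notin> B"
      using B by blast
    then have "v1 = v2" if "v1 \<in> B" "v2 \<in> B" for v1 v2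
      using assms block_not_connected[OF blk] that B by blast
    with B show "is_singleton B"
      by (meson is_singletonI')
  qed
qed

lemma primitive_if_prime_card:
  assumes "Factorial_Ring.prime (card V)"
  shows "primitive_group V S"
  unfolding primitive_group_def
proof (intro conjI allI impI transitive)
  fix B assume blk: "block V S B"
  then have "card B dvd card V"
    using finite_V by (intro card_dvd_if_translates_eq_or_disjoint) (auto simp: block_iff)
  then have "card B = 1 \<or> card B = card V"
    using assms by (auto simp: prime_nat_iff)
  then show "is_singleton B \<or> B = V"
    using card_subset_eq[OF finite_V, of B] blk by (auto simp: is_singleton_altdef block_iff)
qed

lemma primitive_not_connected_imp_stab_eq:
  assumes prim: "primitive_group V S" and v: "v1 \<in> V" "v2 \<in> V"
    and nconn: "\<not> Digraph_Component.connected (orbit_graph V S v1 v2)"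
  shows "stab v1 = stab v2"
proof -
  let ?H = "generate (perm_group V S) (stab v1 \<union> stab v2)"
  have H: "subgroup ?H (perm_group V S)"
    using stabilizer_subset by (intro generate_is_subgroup) auto
  have fixed: "Group_Action.orbit (perm_group V ?H) id v = {v}" if "v \<in> {v1, v2}" for v
    using that v primitive_orbit_subgroup[OF prim H, of v]
      connected_if_generate_transitive[OF v, of v] nconn
    by (auto intro: generate.incl)
  have "\<sigma> v1 = v1 \<and> \<sigma> v2 = v2" if "\<sigma> \<in> ?H" for \<sigma>
    using fixed[of v1] fixed[of v2] that by (auto simp: Group_Action.orbit_def)
  then have "\<sigma> v1 = v1 \<and> \<sigma> v2 = v2" if "\<sigma> \<in> stab v1 \<union> stab v2" for \<sigma>
    using generate.incl[OF that] by blast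
  then show ?thesis
    unfolding stabilizer_def id_apply by blast
qed

lemma primitive_stab_eq_imp_regular:
  assumes prim: "primitive_group V S" and v: "v1 \<in> V" "v2 \<in> V" "v1 \<noteq> v2" "stab v1 = stab v2"
    and w: "w \<in> V"
  shows "stab w = stab v1"
proof -
  define B where "B = {w \<in> V. stab w = stab v1}"
  have fin: "finite B"
    using finite_V by (simp add: B_def)
  have "\<sigma> ` B = B" if "\<sigma> \<in> S" "\<sigma> ` B \<inter> B \<noteq> {}" for \<sigma>
  proof -
    from that obtain x where x: "x \<in> B" "\<sigma> x \<in> B"
      by blast
    have "\<sigma> z \<in> B" if "z \<in> B" for z
    proof -
      have "stab (\<sigma> z) = stab (\<sigma> x)"
        using stabilizer_translate_cong[of z x \<sigma>] x that \<open>\<sigma> \<in> S\<close> by (simp add: B_def)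
      moreover have "\<sigma> z \<in> V"
        using element_image[of \<sigma> z] that \<open>\<sigma> \<in> S\<close> by (simp add: B_def)
      ultimately show ?thesis
        using x(2) by (simp add: B_def)
    qed
    moreover have "inj_on \<sigma> B"
      by (rule inj_on_subset[of _ V]) (use inj_prop[of \<sigma>] \<open>\<sigma> \<in> S\<close> in \<open>auto simp: B_def\<close>)
    ultimately show ?thesis
      using fin by (simp add: endo_inj_surj image_subsetI)
  qed
  moreover have B: "v1 \<in> B" "v2 \<in> B" "B \<subseteq> V"
    using v by (simp_all add: B_def)
  ultimately have "block V S B"
    unfolding block_iff by blast
  then have "is_singleton B \<or> B = V"
    using prim unfolding primitive_group_def by blast
  moreover have "\<not> is_singleton B"
    using B v(3) by (elim contrapos_nn is_singletonE) simp
  ultimately have "B = V"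
    by blast
  with w show ?thesis
    unfolding B_def by blast
qed

lemma trivial_if_fixes_all:
  assumes "\<sigma> \<in> S" "\<And>x. x \<in> V \<Longrightarrow> \<sigma> x = x"
  shows "\<sigma> = \<one>\<^bsub>perm_group V S\<^esub>"
proof -
  have "\<sigma> \<in> extensional V"
    using subsetD[OF subgroup.subset[OF subgroup_S] assms(1)] by (simp add: BijGroup_def Bij_def)
  then have "\<sigma> = (\<lambda>x\<in>V. x)"
    using assms(2) by (intro extensionalityI[of _ V]) auto
  then show ?thesis
    by (simp add: BijGroup_def)
qed

lemma order_eq_card_if_stab_trivial:
  assumes "v \<in> V" "stab v = {\<one>\<^bsub>perm_group V S\<^esub>}"
  shows "Coset.order (perm_group V S) = card V"
  using orbit_stabilizer_theorem[OF assms(1)] orbit_eq[OF assms(1)] assms(2) by simp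

lemma primitive_regular_imp_prime_card:
  assumes prim: "primitive_group V S" and v: "v \<in> V" "stab v = {\<one>\<^bsub>perm_group V S\<^esub>}"
    and "card V \<noteq> 1"
  shows "Factorial_Ring.prime (card V)"
proof -
  obtain p where p: "Factorial_Ring.prime p" "p dvd card V"
    using prime_factor_nat[OF assms(4)] by (elim exE conjE)
  then obtain m where "Coset.order (perm_group V S) = p ^ 1 * m"
    using order_eq_card_if_stab_trivial[OF v] by (auto elim: dvdE)
  then obtain H where H: "subgroup H (perm_group V S)" "card H = p"
    using sylow_thm[OF p(1) is_group, of 1 m] finite_S by auto
  interpret H: group_action "perm_group V H" V id
    using induced_action[OF H(1)] by simp
  have "stab v \<subseteq> H"
    using subgroup.one_closed[OF H(1)] unfolding v(2) by blast
  from primitive_orbit_subgroup[OF prim H(1) v(1) this]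
  have "card (Group_Action.orbit (perm_group V H) id v) \<in> {1, card V}"
    by (elim disjE) simp_all
  moreover have "stabilizer (perm_group V H) id v = {\<one>\<^bsub>perm_group V S\<^esub>}"
    using \<open>stab v \<subseteq> H\<close> subgroup.subset[OF H(1)] unfolding v(2)[symmetric] stabilizer_def by auto
  then have "card (Group_Action.orbit (perm_group V H) id v) = p"
    using H.orbit_stabilizer_theorem[OF v(1)] H(2) by (simp add: Coset.order_def)
  ultimately have "p = card V"
    using prime_gt_Suc_0_nat[OF p(1)] by (elim insertE) simp_all
  with p(1) show ?thesis
    by simp
qed

lemma matching_if_stab_trivial:
  assumes "\<And>v. v \<in> V \<Longrightarrow> stab v = {\<one>\<^bsub>perm_group V S\<^esub>}" "v1 \<in> V" "v2 \<in> V"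
  shows "perfect_matching_graph (orbit_graph V S v1 v2)"
    and "card (undirected_edges (orbit_graph V S v1 v2)) = card V"
proof -
  have orb: "stab_orbits V S v = (\<lambda>x. {x}) ` V" if "v \<in> V" for v
  proof -
    have "stab_orbit v x = {x}" if "x \<in> V" for x
      using that unfolding assms(1)[OF \<open>v \<in> V\<close>] by (simp add: Group_Action.orbit_def BijGroup_def)
    then show ?thesis
      unfolding stab_orbits_eq by (rule image_cong[OF refl])
  qed
  have edges: "undirected_edges (orbit_graph V S v1 v2) = (\<lambda>x. {Inl {x}, Inr {x}}) ` V"
    unfolding undirected_edges_orbit_graph orb[OF assms(2)] orb[OF assms(3)] by auto
  show "card (undirected_edges (orbit_graph V S v1 v2)) = card V"
    unfolding edges by (intro card_image) (auto simp: inj_on_def doubleton_eq_iff)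
  show "perfect_matching_graph (orbit_graph V S v1 v2)"
    unfolding perfect_matching_graph_def edges
  proof
    fix u assume "u \<in> verts (orbit_graph V S v1 v2)"
    then obtain x where x: "x \<in> V" and u: "u = Inl {x} \<or> u = Inr {x}"
      unfolding orbit_graph_def by (auto simp: orb[OF assms(2)] orb[OF assms(3)])
    show "\<exists>!e. e \<in> (\<lambda>x. {Inl {x}, Inr {x}}) ` V \<and> u \<in> e"
      using x u by (intro ex1I[of _ "{Inl {x}, Inr {x}}"]) auto
  qed
qed

lemma matching_imp_stab_trivial:
  assumes v: "v1 \<in> V"
    and pm: "perfect_matching_graph (orbit_graph V S v1 v2)"
    and card: "card (undirected_edges (orbit_graph V S v1 v2)) = card V"
  shows "stab v1 = {\<one>\<^bsub>perm_group V S\<^esub>}"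
proof -
  interpret A: group_action "perm_group V (stab v1)" V id
    using v by (rule stab_action)
  let ?E = "undirected_edges (orbit_graph V S v1 v2)"
  have "?E \<subseteq> (\<lambda>Q. THE e. e \<in> ?E \<and> Inl Q \<in> e) ` stab_orbits V S v1"
  proof
    fix e assume e: "e \<in> ?E"
    then obtain Q where Q: "Q \<in> stab_orbits V S v1" "Inl Q \<in> e"
      unfolding undirected_edges_orbit_graph by blast
    then have "Inl Q \<in> verts (orbit_graph V S v1 v2)"
      by (simp add: orbit_graph_def InlI)
    with pm have "\<exists>!e. e \<in> ?E \<and> Inl Q \<in> e"
      unfolding perfect_matching_graph_def by (rule bspec)
    from the1_equality[OF this] e Q(2) have "e = (THE e. e \<in> ?E \<and> Inl Q \<in> e)"
      by simp
    then show "e \<in> (\<lambda>Q. THE e. e \<in> ?E \<and> Inl Q \<in> e) ` stab_orbits V S v1"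
      using Q(1) by (rule image_eqI)
  qed
  then have "card V \<le> card (stab_orbits V S v1)"
    unfolding card[symmetric] using finite_V by (intro surj_card_le) (simp add: stab_orbits_eq)
  then have inj: "inj_on (stab_orbit v1) V"
    using finite_V unfolding stab_orbits_eq by (intro eq_card_imp_inj_on le_antisym card_image_le)
  have "\<sigma> = \<one>\<^bsub>perm_group V S\<^esub>" if "\<sigma> \<in> stab v1" for \<sigma>
  proof (rule trivial_if_fixes_all)
    show S: "\<sigma> \<in> S"
      using that stabilizer_subset by auto
    fix x assume x: "x \<in> V"
    then have \<sigma>x: "\<sigma> x \<in> V"
      using S element_image[of \<sigma> x] by simp
    have "\<sigma> x \<in> stab_orbit v1 x"
      using that by (auto simp: Group_Action.orbit_def)
    then have "stab_orbit v1 (\<sigma> x) = stab_orbit v1 x"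
      by (rule A.orbit_cong[OF x])
    then show "\<sigma> x = x"
      using inj x \<sigma>x by (simp add: inj_on_eq_iff)
  qed
  with stabilizer_one_closed[OF v] show ?thesis
    by blast
qed

end

theorem theorem2p8:
  fixes V :: "'a set" and S :: "('a \<Rightarrow> 'a) set"
  assumes "finite V"
    and "subgroup S (BijGroup V)"
    and "transitive_action (perm_group V S) V id"
  defines "case_i \<equiv>
      \<forall>v1 \<in> V. \<forall>v2 \<in> V. v1 \<noteq> v2 \<longrightarrow> Digraph_Component.connected (orbit_graph V S v1 v2)"
    and "case_ii \<equiv>
      (\<forall>v1 \<in> V. \<forall>v2 \<in> V. v1 \<noteq> v2 \<longrightarrow>
         perfect_matching_graph (orbit_graph V S v1 v2) \<and>
         card (undirected_edges (orbit_graph V S v1 v2)) = card V) \<and>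
      Factorial_Ring.prime (card V)"
  shows "(primitive_group V S \<longleftrightarrow> case_i \<or> case_ii) \<and>
    (case_ii \<longrightarrow> cyclic_group (perm_group V S) \<and>
       Factorial_Ring.prime (Coset.order (perm_group V S)))"
proof -
  interpret transitive_perm_group V S
    using assms(1-3) by (rule transitive_perm_group.intro)
  have "case_ii" if prim: "primitive_group V S" and "\<not> case_i"
  proof -
    obtain v1 v2 where v: "v1 \<in> V" "v2 \<in> V" "v1 \<noteq> v2"
      and "\<not> Digraph_Component.connected (orbit_graph V S v1 v2)"
      using \<open>\<not> case_i\<close> by (auto simp: case_i_def)
    then have "stab v1 = stab v2"
      using primitive_not_connected_imp_stab_eq[OF prim] by blast
    then have eq: "stab w = stab v1" if "w \<in> V" for w
      using primitive_stab_eq_imp_regular[OF prim v] that by blast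
    have "\<sigma> = \<one>\<^bsub>perm_group V S\<^esub>" if "\<sigma> \<in> stab v1" for \<sigma>
    proof (rule trivial_if_fixes_all)
      show "\<sigma> \<in> S"
        using that by (simp add: stabilizer_def)
      show "\<sigma> x = x" if "x \<in> V" for x
        using \<open>\<sigma> \<in> stab v1\<close> unfolding eq[OF that, symmetric] by (simp add: stabilizer_def)
    qed
    then have triv: "stab w = {\<one>\<^bsub>perm_group V S\<^esub>}" if "w \<in> V" for w
      using eq[OF that] stabilizer_one_closed[OF v(1)] by blast
    have "card V \<noteq> 1"
      using v by (metis card_1_singletonE singletonD)
    then have "Factorial_Ring.prime (card V)"
      by (rule primitive_regular_imp_prime_card[OF prim v(1) triv[OF v(1)]])
    with matching_if_stab_trivial[OF triv] show ?thesis
      unfolding case_ii_def by blast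
  qed
  moreover have "primitive_group V S" if "case_i \<or> case_ii"
    using that primitive_if_connected primitive_if_prime_card unfolding case_i_def case_ii_def by blast
  moreover have "cyclic_group (perm_group V S) \<and> Factorial_Ring.prime (Coset.order (perm_group V S))"
    if "case_ii"
  proof -
    have "card V > 1"
      using that prime_gt_1_nat unfolding case_ii_def by blast
    then have "\<not> card V \<le> Suc 0"
      by simp
    then obtain v1 v2 where v: "v1 \<in> V" "v2 \<in> V" "v1 \<noteq> v2"
      unfolding card_le_Suc0_iff_eq[OF finite_V] by blast
    then have "stab v1 = {\<one>\<^bsub>perm_group V S\<^esub>}"
      using that matching_imp_stab_trivial[of v1 v2] unfolding case_ii_def by blast
    then have "Factorial_Ring.prime (Coset.order (perm_group V S))"
      using that order_eq_card_if_stab_trivial[OF v(1)] by (simp add: case_ii_def)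
    from prime_order_imp_cyclic[OF this] this show ?thesis
      by (rule conjI)
  qed
  ultimately show ?thesis
    by blast
qed

end
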